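(* Let $G$ be an $n$-vertex graph with $n-1$ edges that has the Sidorenko property, and let $k\in\{1,2,3,4,5\}$. Then the $k$-apex $G^{+k}$ of $G$ is common.
   Context: All graphs are finite and simple. The $k$-apex $G^{+k}$ of a graph $G$ is the graph obtained from $G$ by adding $k$ new vertices, each adjacent to every vertex of $G$, where the $k$ new vertices form an independent set. A graphon is a symmetric measurable function $W:[0,1]^2\to[0,1]$. For a graph $H$, the homomorphism density is $t(H,W)=\int_{[0,1]^{V(H)}}\prod_{uv\in E(H)}W(x_u,x_v)\,dx_{V(H)}$. A graph $H$ with $e(H)$ edges has the Sidorenko property if $t(H,W)\ge t(K_2,W)^{e(H)}$ for every graphon $W$. The monochromatic density is $m(H,W)=t(H,W)+t(H,1-W)$, where $(1-W)(x,y)=1-W(x,y)$, and $H$ is common if $m(H,W)\ge 2^{1-e(H)}$ for every graphon $W$. *)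

theory Defs
  imports "HOL-Analysis.Analysis"
begin

record 'a graph =
  verts :: "'a set"
  edges :: "'a set set"

definition simple_graph :: "'a graph \<Rightarrow> bool" where
  "simple_graph G \<longleftrightarrow> finite (verts G) \<and> (\<forall>e\<in>edges G. e \<subseteq> verts G \<and> card e = 2)"

definition K2 :: "nat graph" where
  "K2 = \<lparr>verts = {0, 1}, edges = {{0, 1}}\<rparr>"

(* The original vertices are tagged Inl, the k new ones are Inr 0, ..., Inr (k - 1). *)
definition apex :: "nat \<Rightarrow> 'a graph \<Rightarrow> ('a + nat) graph" where
  "apex k G =
     \<lparr>verts = Inl ` verts G \<union> Inr ` {..<k},
      edges = (\<lambda>e. Inl ` e) ` edges G \<union> {{Inl v, Inr i} | v i. v \<in> verts G \<and> i < k}\<rparr>"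

lemma simple_graph_apex:
  assumes "simple_graph G"
  shows "simple_graph (apex k G)"
  using assms by (auto simp: simple_graph_def apex_def card_image)

definition I01 :: "real measure" where
  "I01 = restrict_space lborel {0..1}"

(* "Measurable" is Borel measurable on the unit square.  Values of W outside the unit square
   are irrelevant: they are neither constrained here nor seen by the densities below. *)
definition graphon :: "(real \<Rightarrow> real \<Rightarrow> real) \<Rightarrow> bool" where
  "graphon W \<longleftrightarrow>
     (\<lambda>(x, y). W x y) \<in> borel_measurable (I01 \<Otimes>\<^sub>M I01) \<and>
     (\<forall>x\<in>{0..1}. \<forall>y\<in>{0..1}. W x y = W y x \<and> W x y \<in> {0..1})"

(* The value W (x u) (x v) of the unordered edge {u, v}; it is well defined because W is
   symmetric on the unit square (lemma edge_weight_doubleton). *)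
definition edge_weight :: "(real \<Rightarrow> real \<Rightarrow> real) \<Rightarrow> ('a \<Rightarrow> real) \<Rightarrow> 'a set \<Rightarrow> real" where
  "edge_weight W x e = (THE w. \<forall>u v. e = {u, v} \<longrightarrow> w = W (x u) (x v))"

lemma edge_weight_doubleton:
  assumes "W (x u) (x v) = W (x v) (x u)"
  shows "edge_weight W x {u, v} = W (x u) (x v)"
  unfolding edge_weight_def
  by (rule the_equality) (use assms in \<open>auto simp: doubleton_eq_iff\<close>)

definition hom_density :: "'a graph \<Rightarrow> (real \<Rightarrow> real \<Rightarrow> real) \<Rightarrow> real" where
  "hom_density H W =
     (\<integral>x. (\<Prod>e\<in>edges H. edge_weight W x e) \<partial>(\<Pi>\<^sub>M v\<in>verts H. I01))"

definition sidorenko :: "'a graph \<Rightarrow> bool" where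
  "sidorenko H \<longleftrightarrow>
     (\<forall>W. graphon W \<longrightarrow> hom_density H W \<ge> hom_density K2 W ^ card (edges H))"

definition mono_density :: "'a graph \<Rightarrow> (real \<Rightarrow> real \<Rightarrow> real) \<Rightarrow> real" where
  "mono_density H W = hom_density H W + hom_density H (\<lambda>x y. 1 - W x y)"

definition common_graph :: "'a graph \<Rightarrow> bool" where
  "common_graph H \<longleftrightarrow>
     (\<forall>W. graphon W \<longrightarrow> mono_density H W \<ge> 2 powr (1 - real (card (edges H))))"

end

theory Submission
  imports Defs "HOL-Probability.Weak_Convergence" "HOL-Probability.Infinite_Product_Measure"
begin

text \<open>
  Fix the images \<open>y\<close> of the \<open>k\<close> apex vertices and put \<open>f x = (\<Prod>i<k. W x (y i))\<close>. The Sidorenko property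
  of \<open>G\<close>, applied to the measure with density proportional to \<open>f\<close>, bounds the density of extensions
  below by \<open>F * (D / F) ^ m\<close>, where \<open>m\<close> is the number of edges of \<open>G\<close>, \<open>F = \<integral>f\<close> and
  \<open>D = \<integral>\<integral>W x x' * f x * f x'\<close>. Replacing \<open>r ^ m\<close> by its tangent at \<open>r = a = (1/2) ^ (k + 1)\<close> makes this
  linear in \<open>D\<close> and \<open>F\<close>, and averaging over \<open>y\<close> turns these into the densities of the \<open>k\<close>-apex of
  an edge and of the star with \<open>k\<close> leaves. As stars are common, it then suffices that the
  monochromatic density of the former is at least \<open>a\<close> times that of the latter.
  If \<open>q\<close> is the mean of \<open>(2 * deg W x - 1)\<^sup>2\<close>, tangents at \<open>1/4\<close> and Goodman's triangle identity bound the former below by \<open>(1/4) ^ k * (1 + 3 * k * q)\<close>,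
  while the latter is at most \<open>2 * (1/2) ^ k * (1 + (2 ^ (k - 1) - 1) * q)\<close>;
  the condition \<open>2 ^ (k - 1) - 1 \<le> 3 * k\<close> holds precisely for \<open>k \<le> 5\<close>.
\<close>

subsection \<open>Graphons and transport of measure\<close>

text \<open>This is convexity of \<open>r ^ m\<close>, in the form of its tangent at
  \<open>a\<close>. The induction uses that \<open>r - a\<close> and \<open>r ^ m - a ^ m\<close>
  have the same sign. For \<open>m = 0\<close> the truncated exponent \<open>m - 1\<close> is
  harmless because its coefficient vanishes.\<close>

lemma power_ge_tangent:
  fixes r a :: real
  assumes "0 \<le> r" "0 \<le> a"
  shows "real m * a ^ (m - 1) * r - (real m - 1) * a ^ m \<le> r ^ m"
proof (induction m)
  case (Suc m)
  have "(r - a) * (r ^ m - a ^ m) \<ge> 0"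
    using assms by (cases "r \<le> a")
      (auto simp: power_mono mult_nonpos_nonpos intro!: mult_nonneg_nonneg)
  then have "r ^ Suc m \<ge> a ^ m * r + a * (r ^ m) - a ^ Suc m"
    by (simp add: algebra_simps)
  moreover have "a * (r ^ m) \<ge> a * (real m * a ^ (m - 1) * r - (real m - 1) * a ^ m)"
    using Suc assms by (intro mult_left_mono)
  moreover have "a * (real m * a ^ (m - 1) * r - (real m - 1) * a ^ m) =
      real m * a ^ m * r - (real m - 1) * a ^ Suc m"
    by (cases m) (auto simp: algebra_simps)
  ultimately have "r ^ Suc m \<ge> a ^ m * r + (real m * a ^ m * r - (real m - 1) * a ^ Suc m) - a ^ Suc m"
    by linarith
  then show ?case
    by (simp add: algebra_simps)
qed auto

lemma (in prob_space) integrable_unit_valued: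
  fixes f :: "'a \<Rightarrow> real"
  assumes "f \<in> borel_measurable M" "\<And>x. x \<in> space M \<Longrightarrow> f x \<in> {0..1}"
  shows "integrable M f"
  using assms by (intro integrable_const_bound[where B = 1]) auto

lemma space_I01 [simp]: "space I01 = {0..1}"
  by (simp add: I01_def space_restrict_space)

interpretation I01: prob_space I01
  by (rule prob_spaceI) (simp add: I01_def emeasure_restrict_space space_restrict_space)

interpretation I01_pair: pair_prob_space I01 I01 ..

interpretation I01_prod: product_sigma_finite "\<lambda>_. I01" ..

lemma graphonD:
  assumes "graphon W"
  shows "(\<lambda>(x, y). W x y) \<in> borel_measurable (I01 \<Otimes>\<^sub>M I01)"
    and "\<And>x y. x \<in> {0..1} \<Longrightarrow> y \<in> {0..1} \<Longrightarrow> W x y = W y x"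
    and "\<And>x y. x \<in> {0..1} \<Longrightarrow> y \<in> {0..1} \<Longrightarrow> 0 \<le> W x y"
    and "\<And>x y. x \<in> {0..1} \<Longrightarrow> y \<in> {0..1} \<Longrightarrow> W x y \<le> 1"
  using assms by (auto simp: graphon_def)

lemma graphon_complement: "graphon W \<Longrightarrow> graphon (\<lambda>x y. 1 - W x y)"
  by (auto simp: graphon_def split_beta')

text \<open>\<open>Q\<close> is essentially the quantile function of the probability density
  \<open>g\<close>. \<open>sidorenko\<close> speaks only of the uniform measure on the unit
  interval, so a weighted measure must be realised there as an image of the uniform one.\<close>

lemma quantile_transport:
  fixes g :: "real \<Rightarrow> real"
  assumes [measurable]: "g \<in> borel_measurable I01"
    and nonneg: "\<And>x. x \<in> {0..1} \<Longrightarrow> 0 \<le> g x"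
    and int: "integrable I01 g" and one: "integral\<^sup>L I01 g = 1"
  obtains Q where "Q \<in> I01 \<rightarrow>\<^sub>M I01" "distr I01 I01 Q = density I01 (\<lambda>x. ennreal (g x))"
proof -
  let ?N = "density I01 (\<lambda>x. ennreal (g x))"
  have [measurable]: "(\<lambda>x. x) \<in> I01 \<rightarrow>\<^sub>M borel"
    unfolding I01_def by (intro measurable_restrict_space1) simp
  have "emeasure ?N (space ?N) = (\<integral>\<^sup>+x. ennreal (g x) \<partial>I01)"
    using sets.top[of I01] by (auto simp: emeasure_density intro!: nn_integral_cong)
  also have "\<dots> = 1"
    using nonneg int one by (subst nn_integral_eq_integral) auto
  finally have N1: "emeasure ?N (space ?N) = 1" .
  interpret N: prob_space ?N
    by (rule prob_spaceI) (rule N1)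
  \<comment> \<open>Quantile functions are taken of distributions on the whole line, so the measure
    is first pushed there along the inclusion.\<close>
  define M where "M = distr ?N borel (\<lambda>x. x)"
  interpret M: cdf_distribution M
    unfolding cdf_distribution_def M_def by (intro N.real_distribution_distr) simp
  let ?J = "restrict_space lborel {0<..<1::real}"
  have "M.I \<in> borel_measurable ?J"
    using M.measurable_CI by (simp add: measurable_cong_sets[OF sets_restrict_space_cong[OF sets_lborel] refl])
  with M.distr_I_eq_M obtain I where Ib: "I \<in> borel_measurable ?J" and I: "distr ?J borel I = M"
    by blast
  \<comment> \<open>The quantile function is considered on the open unit interval only and might
    leave \<open>{0..1}\<close>. \<open>Q\<close> gets the default value 0 at such points; they form
    the set \<open>N\<close> below, which is null because \<open>M\<close> is concentrated on
    \<open>{0..1}\<close>.\<close>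
  define Q where "Q u = (if u \<in> {0<..<1} \<and> I u \<in> {0..1} then I u else 0)" for u
  have Im: "{u \<in> {0<..<1}. I u \<in> A} \<in> sets borel" if "A \<in> sets borel" for A
  proof -
    have "I -` A \<inter> space ?J \<in> sets ?J"
      using Ib that by (rule measurable_sets)
    also have "I -` A \<inter> space ?J = {u \<in> {0<..<1}. I u \<in> A}"
      by (auto simp: space_restrict_space)
    finally show ?thesis
      by (simp add: sets_restrict_space_iff)
  qed
  have MI: "emeasure M A = emeasure lborel {u \<in> {0<..<1}. I u \<in> A}" if "A \<in> sets borel" for A
  proof -
    have "emeasure M A = emeasure (distr ?J borel I) A"
      by (simp add: I)
    also have "\<dots> = emeasure ?J (I -` A \<inter> space ?J)"
      using that Ib by (subst emeasure_distr) auto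
    also have "I -` A \<inter> space ?J = {u \<in> {0<..<1}. I u \<in> A}"
      by (auto simp: space_restrict_space)
    finally show ?thesis
      by (simp add: emeasure_restrict_space subset_eq)
  qed
  have MN: "emeasure M A = emeasure ?N (A \<inter> {0..1})" if "A \<in> sets borel" for A
    unfolding M_def using that by (subst emeasure_distr) auto
  define N where "N = {0..1} - {u \<in> {0<..<1}. I u \<in> {0..1}}"
  \<comment> \<open>Preimages under \<open>Q\<close> and under \<open>I\<close> differ by at most
    \<open>N\<close>, and only when the default value 0 lies in \<open>A\<close>.\<close>
  have Qset: "{u \<in> {0..1}. Q u \<in> A} = {u \<in> {0<..<1}. I u \<in> A \<inter> {0..1}} \<union> (if 0 \<in> A then N else {})" for A
    by (auto simp: Q_def N_def)
  have Nb: "N \<in> sets borel"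
    unfolding N_def by (intro sets.Diff Im) auto
  have "emeasure M {0..1} = 1"
    using N1 by (subst MN) simp_all
  then have I1: "emeasure lborel {u \<in> {0<..<1}. I u \<in> {0..1}} = 1"
    by (subst (asm) MI) (simp_all only: atLeastAtMost_borel)
  have "emeasure lborel N = emeasure lborel {0..1::real} - emeasure lborel {u \<in> {0<..<1}. I u \<in> {0..1}}"
    unfolding N_def
  proof (rule emeasure_Diff)
    show "emeasure lborel {u \<in> {0<..<1}. I u \<in> {0..1}} \<noteq> \<infinity>"
      by (simp only: I1) simp
    show "{u \<in> {0<..<1}. I u \<in> {0..1}} \<in> sets lborel"
      by (simp only: sets_lborel Im atLeastAtMost_borel)
    show "{u \<in> {0<..<1}. I u \<in> {0..1}} \<subseteq> {0..1}"
      by auto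
  qed simp
  then have "emeasure lborel N = 0"
    by (simp only: I1) simp
  with Nb have N: "(if 0 \<in> A then N else {}) \<in> null_sets lborel" for A :: "real set"
    by (auto intro: null_setsI)
  have bor: "A \<in> sets borel" if "A \<in> sets I01" for A
    using that by (auto simp: I01_def sets_restrict_space_iff)
  have Q: "Q \<in> I01 \<rightarrow>\<^sub>M I01"
  proof (rule measurableI)
    fix A assume A: "A \<in> sets I01"
    have "Q -` A \<inter> space I01 = {u \<in> {0..1}. Q u \<in> A}"
      by auto
    moreover have "\<dots> \<in> sets borel"
      unfolding Qset using Im[of "A \<inter> {0..1}"] bor[OF A] Nb by (intro sets.Un) simp_all
    ultimately show "Q -` A \<inter> space I01 \<in> sets I01"
      by (auto simp: I01_def sets_restrict_space_iff)
  qed (auto simp: Q_def)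
  have "distr I01 I01 Q = ?N"
  proof (rule measure_eqI)
    fix A assume "A \<in> sets (distr I01 I01 Q)"
    then have A: "A \<in> sets I01" by simp
    note Ab = bor[OF A]
    have "emeasure (distr I01 I01 Q) A = emeasure I01 {u \<in> {0..1}. Q u \<in> A}"
      using Q A by (subst emeasure_distr) (auto intro!: arg_cong[where f = "emeasure I01"])
    also have "\<dots> = emeasure lborel {u \<in> {0..1}. Q u \<in> A}"
      by (simp add: I01_def emeasure_restrict_space subset_eq)
    also have "\<dots> = emeasure lborel {u \<in> {0<..<1}. I u \<in> A \<inter> {0..1}}"
      unfolding Qset using N[of A] Im[of "A \<inter> {0..1}"] Ab by (intro emeasure_Un_null_set) simp_all
    also have "\<dots> = emeasure ?N (A \<inter> {0..1})"
      using MI[of "A \<inter> {0..1}"] MN[of "A \<inter> {0..1}"] Ab by (simp add: ac_simps)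
    also have "A \<inter> {0..1} = A"
      using sets.sets_into_space[OF A] by auto
    finally show "emeasure (distr I01 I01 Q) A = emeasure ?N A" .
  qed simp
  with Q show thesis by (rule that)
qed

text \<open>A change of variables in every coordinate at once: the product of the densities is the
  density of the product measure, which is the image of the uniform product measure under
  \<open>Q\<close> applied coordinatewise.\<close>

lemma integral_PiM_transport:
  fixes h :: "('i \<Rightarrow> real) \<Rightarrow> real"
  assumes V: "finite V" and Q[measurable]: "Q \<in> I01 \<rightarrow>\<^sub>M I01"
    and g[measurable]: "g \<in> borel_measurable I01"
    and nonneg: "\<And>x. x \<in> {0..1} \<Longrightarrow> 0 \<le> g x"
    and dist: "distr I01 I01 Q = density I01 (\<lambda>x. ennreal (g x))"
    and h[measurable]: "h \<in> borel_measurable (\<Pi>\<^sub>M v\<in>V. I01)"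
  shows "(\<integral>x. (\<Prod>v\<in>V. g (x v)) * h x \<partial>(\<Pi>\<^sub>M v\<in>V. I01)) =
    (\<integral>u. h (compose V Q u) \<partial>(\<Pi>\<^sub>M v\<in>V. I01))"
proof -
  let ?P = "\<Pi>\<^sub>M v\<in>V. I01"
  let ?N = "density I01 (\<lambda>x. ennreal (g x))"
  interpret N: prob_space ?N
    unfolding dist[symmetric] by (rule I01.prob_space_distr) (rule Q)
  interpret NP: product_sigma_finite "\<lambda>_. ?N" ..
  have sets_eq: "sets (\<Pi>\<^sub>M v\<in>V. ?N) = sets ?P"
    by (intro sets_PiM_cong) auto
  \<comment> \<open>The two measures are compared on boxes, where both factor into one-dimensional
    integrals.\<close>
  have "density ?P (\<lambda>x. ennreal (\<Prod>v\<in>V. g (x v))) = (\<Pi>\<^sub>M v\<in>V. ?N)"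
  proof (rule NP.PiM_eqI[OF V])
    fix A assume A: "\<And>v. v \<in> V \<Longrightarrow> A v \<in> sets ?N"
    then have A'[measurable]: "\<And>v. v \<in> V \<Longrightarrow> A v \<in> sets I01" by simp
    have "emeasure (density ?P (\<lambda>x. ennreal (\<Prod>v\<in>V. g (x v)))) (Pi\<^sub>E V A) =
        (\<integral>\<^sup>+x. ennreal (\<Prod>v\<in>V. g (x v)) * indicator (Pi\<^sub>E V A) x \<partial>?P)"
      using V A' by (intro emeasure_density sets_PiM_I_finite) auto
    also have "\<dots> = (\<integral>\<^sup>+x. (\<Prod>v\<in>V. ennreal (g (x v)) * indicator (A v) (x v)) \<partial>?P)"
    proof (rule nn_integral_cong)
      fix x assume x: "x \<in> space ?P"
      then have "\<And>v. v \<in> V \<Longrightarrow> 0 \<le> g (x v)"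
        using nonneg by (auto simp: space_PiM PiE_iff)
      moreover have "indicator (Pi\<^sub>E V A) x = (\<Prod>v\<in>V. indicator (A v) (x v) :: ennreal)"
      proof (cases "x \<in> Pi\<^sub>E V A")
        case False
        then obtain v where "v \<in> V" "x v \<notin> A v"
          using x by (auto simp: space_PiM PiE_iff)
        then have "(\<Prod>v\<in>V. indicator (A v) (x v) :: ennreal) = 0"
          using V by (intro prod_zero bexI[of _ v]) auto
        with False show ?thesis by simp
      qed (auto simp: PiE_iff)
      ultimately show "ennreal (\<Prod>v\<in>V. g (x v)) * indicator (Pi\<^sub>E V A) x =
          (\<Prod>v\<in>V. ennreal (g (x v)) * indicator (A v) (x v))"
        by (simp add: prod.distrib prod_ennreal)
    qed
    also have "\<dots> = (\<Prod>v\<in>V. \<integral>\<^sup>+x. ennreal (g x) * indicator (A v) x \<partial>I01)"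
      using V by (intro I01_prod.product_nn_integral_prod) auto
    also have "\<dots> = (\<Prod>v\<in>V. emeasure ?N (A v))"
      by (intro prod.cong refl) (simp add: emeasure_density)
    finally show "emeasure (density ?P (\<lambda>x. ennreal (\<Prod>v\<in>V. g (x v)))) (Pi\<^sub>E V A) =
        (\<Prod>v\<in>V. emeasure ?N (A v))" .
  qed (simp add: sets_eq)
  also have "\<dots> = (\<Pi>\<^sub>M v\<in>V. distr I01 I01 Q)"
    by (simp add: dist)
  also have "\<dots> = distr ?P ?P (compose V Q)"
    using V by (intro distr_PiM_finite_prob_space'[symmetric]) (auto intro: I01.prob_space_axioms)
  finally have eq: "density ?P (\<lambda>x. ennreal (\<Prod>v\<in>V. g (x v))) = distr ?P ?P (compose V Q)" .
  have "(\<integral>x. (\<Prod>v\<in>V. g (x v)) * h x \<partial>?P) = integral\<^sup>L (density ?P (\<lambda>x. ennreal (\<Prod>v\<in>V. g (x v)))) h"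
    using nonneg
    by (subst integral_density) (auto intro!: AE_I2 prod_nonneg simp: space_PiM PiE_iff)
  also have "\<dots> = (\<integral>u. h (compose V Q u) \<partial>?P)"
    unfolding eq by (rule integral_distr) (simp_all add: compose_def[abs_def])
  finally show ?thesis .
qed

subsection \<open>Vertex-weighted Sidorenko inequality\<close>

text \<open>This removes the definite description in \<open>edge_weight\<close>. The endpoints are
  chosen before \<open>W\<close> and \<open>x\<close>, so that one choice serves both a graphon and
  its pullback.\<close>

lemma edge_weight_edge:
  assumes "simple_graph G" "e \<in> edges G"
  obtains u v where "e = {u, v}" "u \<in> verts G" "v \<in> verts G"
    "\<And>W x. graphon W \<Longrightarrow> x u \<in> {0..1} \<Longrightarrow> x v \<in> {0..1} \<Longrightarrow> edge_weight W x e = W (x u) (x v)"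
proof -
  have "e \<subseteq> verts G" "card e = 2"
    using assms by (auto simp: simple_graph_def)
  then obtain u v where "e = {u, v}" "u \<in> verts G" "v \<in> verts G"
    by (auto simp: card_2_iff)
  moreover from this(1) have "edge_weight W x e = W (x u) (x v)"
    if "graphon W" "x u \<in> {0..1}" "x v \<in> {0..1}" for W x
    using edge_weight_doubleton[of W x u v] graphonD(2)[OF that] \<open>e = {u, v}\<close> by simp
  ultimately show thesis by (rule that)
qed

lemma edge_weight_range:
  assumes "simple_graph G" "e \<in> edges G" "graphon W" "x \<in> space (\<Pi>\<^sub>M v\<in>verts G. I01)"
  shows "edge_weight W x e \<in> {0..1}"
proof -
  obtain u v where uv: "u \<in> verts G" "v \<in> verts G"
    "x u \<in> {0..1} \<Longrightarrow> x v \<in> {0..1} \<Longrightarrow> edge_weight W x e = W (x u) (x v)"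
    using edge_weight_edge[OF assms(1,2)] assms(3) by metis
  moreover from uv(1,2) assms(4) have "x u \<in> {0..1}" "x v \<in> {0..1}"
    by (auto simp: space_PiM PiE_iff)
  ultimately show ?thesis
    using graphonD(3,4)[OF assms(3)] by auto
qed

lemma measurable_edge_weight:
  assumes "simple_graph G" "e \<in> edges G" "graphon W"
  shows "(\<lambda>x. edge_weight W x e) \<in> borel_measurable (\<Pi>\<^sub>M v\<in>verts G. I01)"
proof -
  obtain u v where uv: "u \<in> verts G" "v \<in> verts G"
    "\<And>x. x u \<in> {0..1} \<Longrightarrow> x v \<in> {0..1} \<Longrightarrow> edge_weight W x e = W (x u) (x v)"
    using edge_weight_edge[OF assms(1,2)] assms(3) by metis
  note [measurable] = graphonD(1)[OF assms(3)] uv(1,2)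
  have "(\<lambda>x. case (x u, x v) of (a, b) \<Rightarrow> W a b) \<in> borel_measurable (\<Pi>\<^sub>M v\<in>verts G. I01)"
    by (rule measurable_compose[OF _ graphonD(1)[OF assms(3)]]) measurable
  then show ?thesis
    by (rule measurable_cong[THEN iffD1, rotated])
      (use uv in \<open>auto simp: space_PiM PiE_iff\<close>)
qed

lemma finite_edges: "simple_graph G \<Longrightarrow> finite (edges G)"
  by (rule finite_subset[of _ "Pow (verts G)"]) (auto simp: simple_graph_def)

lemma simple_graph_K2: "simple_graph K2"
  by (auto simp: simple_graph_def K2_def)

lemma integral_PiM_pair:
  fixes h :: "real \<Rightarrow> real \<Rightarrow> real"
  assumes [measurable]: "(\<lambda>(x, y). h x y) \<in> borel_measurable (I01 \<Otimes>\<^sub>M I01)"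
    and "\<And>x y. x \<in> {0..1} \<Longrightarrow> y \<in> {0..1} \<Longrightarrow> h x y \<in> {0..1}"
  shows "(\<integral>x. h (x 0) (x 1) \<partial>(\<Pi>\<^sub>M v\<in>{0, 1::nat}. I01)) = (\<integral>x. \<integral>y. h x y \<partial>I01 \<partial>I01)"
proof -
  interpret P: prob_space "\<Pi>\<^sub>M v\<in>{0, 1::nat}. I01"
    by (intro prob_space_PiM I01.prob_space_axioms)
  have "(\<lambda>x. case (x 0, x 1) of (a, b) \<Rightarrow> h a b) \<in> borel_measurable (\<Pi>\<^sub>M v\<in>{1, 0::nat}. I01)"
    by (rule measurable_compose[OF _ assms(1)]) measurable
  then have int: "integrable (\<Pi>\<^sub>M v\<in>{1, 0::nat}. I01) (\<lambda>x. h (x 0) (x 1))"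
    using assms(2)
    by (subst insert_commute, intro P.integrable_unit_valued)
      (auto simp: insert_commute space_PiM PiE_iff)
  \<comment> \<open>The index set is written with 1 inserted last, since the inserted coordinate
    becomes the inner integral.\<close>
  have "(\<integral>x. h (x 0) (x 1) \<partial>(\<Pi>\<^sub>M v\<in>{1, 0::nat}. I01)) =
      (\<integral>x. \<integral>y. h (x 0) y \<partial>I01 \<partial>(\<Pi>\<^sub>M v\<in>{0::nat}. I01))"
    using int by (subst I01_prod.product_integral_insert) auto
  also have "\<dots> = (\<integral>x. \<integral>y. h x y \<partial>I01 \<partial>I01)"
    by (rule I01_prod.product_integral_singleton)
      (rule I01.borel_measurable_lebesgue_integral, measurable)
  finally show ?thesis
    by (simp add: insert_commute)
qed

lemma graphon_pullback:
  assumes "graphon W" and Q[measurable]: "Q \<in> I01 \<rightarrow>\<^sub>M I01"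
  shows "graphon (\<lambda>x y. W (Q x) (Q y))"
proof -
  have "Q x \<in> {0..1}" if "x \<in> {0..1}" for x
    using measurable_space[OF Q] that by simp
  moreover have "(\<lambda>z. case (Q (fst z), Q (snd z)) of (a, b) \<Rightarrow> W a b) \<in> borel_measurable (I01 \<Otimes>\<^sub>M I01)"
    by (rule measurable_compose[OF _ graphonD(1)[OF assms(1)]]) measurable
  ultimately show ?thesis
    using assms(1) by (auto simp: graphon_def split_beta')
qed

text \<open>Pulling a graphon back along \<open>Q\<close> amounts to weighting every vertex by the
  density \<open>g\<close>. This is \<open>integral_PiM_transport\<close> applied to the product of
  the edge weights.\<close>

lemma hom_density_pullback:
  assumes G: "simple_graph G" and W: "graphon W" and Q: "Q \<in> I01 \<rightarrow>\<^sub>M I01"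
    and g: "g \<in> borel_measurable I01" "\<And>x. x \<in> {0..1} \<Longrightarrow> 0 \<le> g x"
    and dist: "distr I01 I01 Q = density I01 (\<lambda>x. ennreal (g x))"
  shows "hom_density G (\<lambda>x y. W (Q x) (Q y)) =
    (\<integral>x. (\<Prod>v\<in>verts G. g (x v)) * (\<Prod>e\<in>edges G. edge_weight W x e) \<partial>(\<Pi>\<^sub>M v\<in>verts G. I01))"
proof -
  have fin: "finite (verts G)"
    using G by (simp add: simple_graph_def)
  have "(\<lambda>x. \<Prod>e\<in>edges G. edge_weight W x e) \<in> borel_measurable (\<Pi>\<^sub>M v\<in>verts G. I01)"
    using G W by (intro borel_measurable_prod measurable_edge_weight)
  from integral_PiM_transport[OF fin Q g dist this]
  have "(\<integral>x. (\<Prod>v\<in>verts G. g (x v)) * (\<Prod>e\<in>edges G. edge_weight W x e) \<partial>(\<Pi>\<^sub>M v\<in>verts G. I01)) =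
      (\<integral>u. (\<Prod>e\<in>edges G. edge_weight W (compose (verts G) Q u) e) \<partial>(\<Pi>\<^sub>M v\<in>verts G. I01))" .
  also have "\<dots> = hom_density G (\<lambda>x y. W (Q x) (Q y))"
    unfolding hom_density_def
  proof (intro Bochner_Integration.integral_cong prod.cong refl)
    fix u e assume u: "u \<in> space (\<Pi>\<^sub>M v\<in>verts G. I01)" and e: "e \<in> edges G"
    obtain a b where ab: "a \<in> verts G" "b \<in> verts G"
      "\<And>W x. graphon W \<Longrightarrow> x a \<in> {0..1} \<Longrightarrow> x b \<in> {0..1} \<Longrightarrow> edge_weight W x e = W (x a) (x b)"
      using edge_weight_edge[OF G e] by metis
    moreover have "u a \<in> {0..1}" "u b \<in> {0..1}"
      using u ab by (auto simp: space_PiM PiE_iff)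
    moreover from this have "Q (u a) \<in> {0..1}" "Q (u b) \<in> {0..1}"
      using measurable_space[OF Q] by auto
    ultimately show "edge_weight W (compose (verts G) Q u) e = edge_weight (\<lambda>x y. W (Q x) (Q y)) u e"
      using W graphon_pullback[OF W Q] by (simp add: compose_def)
  qed
  finally show ?thesis by simp
qed

text \<open>Let \<open>F\<close> and \<open>D\<close> be the two integrals on the left and
  \<open>L\<close> the one on the right. Normalising \<open>f\<close> to the density
  \<open>f / F\<close> and pulling \<open>W\<close> back gives edge density \<open>D / F^2\<close>
  and \<open>G\<close>-density \<open>L / F^(m+1)\<close>, so the Sidorenko property yields
  \<open>L\<close> \<ge> \<open>F * (D / F)^m\<close>. Having one vertex more than edges leaves
  exactly one factor \<open>F\<close>, so the tangent bound becomes linear in \<open>D\<close> and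
  \<open>F\<close>.\<close>

lemma sidorenko_weighted:
  fixes G :: "'a graph" and f :: "real \<Rightarrow> real"
  defines "m \<equiv> card (edges G)"
  assumes G: "simple_graph G" "sidorenko G" "card (verts G) = m + 1"
    and W: "graphon W" and f[measurable]: "f \<in> borel_measurable I01"
    and f01: "\<And>x. x \<in> {0..1} \<Longrightarrow> f x \<in> {0..1}" and a: "0 \<le> a"
  shows "real m * a ^ (m - 1) * (\<integral>x. \<integral>y. W x y * f x * f y \<partial>I01 \<partial>I01) -
      (real m - 1) * a ^ m * (\<integral>x. f x \<partial>I01) \<le>
    (\<integral>x. (\<Prod>e\<in>edges G. edge_weight W x e) * (\<Prod>v\<in>verts G. f (x v)) \<partial>(\<Pi>\<^sub>M v\<in>verts G. I01))"
proof -
  define F where "F = integral\<^sup>L I01 f"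
  define D where "D = (\<integral>x. \<integral>y. W x y * f x * f y \<partial>I01 \<partial>I01)"
  define L where "L = (\<integral>x. (\<Prod>e\<in>edges G. edge_weight W x e) * (\<Prod>v\<in>verts G. f (x v)) \<partial>(\<Pi>\<^sub>M v\<in>verts G. I01))"
  have int: "integrable I01 f"
    using f01 by (intro I01.integrable_unit_valued) auto
  have L0: "0 \<le> L"
    unfolding L_def using edge_weight_range[OF G(1) _ W] f01
    by (intro Bochner_Integration.integral_nonneg mult_nonneg_nonneg prod_nonneg)
      (auto simp: space_PiM PiE_iff)
  have F0: "0 \<le> F"
    unfolding F_def using f01 by (intro Bochner_Integration.integral_nonneg) auto
  have D0: "0 \<le> D"
    unfolding D_def using f01 graphonD(3)[OF W]
    by (intro Bochner_Integration.integral_nonneg) auto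
  have "real m * a ^ (m - 1) * D - (real m - 1) * a ^ m * F \<le> L"
  \<comment> \<open>If \<open>F = 0\<close>, no normalisation is possible, but \<open>f\<close>
    vanishes almost everywhere; then \<open>D = 0\<close> too and the left side is 0.\<close>
  proof (cases "F = 0")
    case True
    then have "AE x in I01. f x = 0"
      using int f01 unfolding F_def by (subst (asm) integral_nonneg_eq_0_iff_AE) auto
    then have "AE x in I01. (\<integral>y. W x y * f x * f y \<partial>I01) = 0"
      by eventually_elim simp
    then have "D = 0"
      unfolding D_def by (rule integral_eq_zero_AE)
    with True L0 show ?thesis by simp
  next
    case False
    with F0 have F: "F > 0" by simp
    define g where "g x = f x / F" for x
    have g[measurable]: "g \<in> borel_measurable I01"
      unfolding g_def by measurable
    have g0: "0 \<le> g x" if "x \<in> {0..1}" for x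
      using f01[OF that] F by (simp add: g_def)
    have "integrable I01 g" "integral\<^sup>L I01 g = 1"
      using int F by (simp_all add: g_def[abs_def] flip: F_def)
    from quantile_transport[OF g g0 this] obtain Q
      where Q: "Q \<in> I01 \<rightarrow>\<^sub>M I01" "distr I01 I01 Q = density I01 (\<lambda>x. ennreal (g x))"
      by metis
    let ?W' = "\<lambda>x y. W (Q x) (Q y)"
    have W': "graphon ?W'"
      using W Q(1) by (rule graphon_pullback)
    have "hom_density G ?W' = (\<integral>x. (\<Prod>v\<in>verts G. g (x v)) * (\<Prod>e\<in>edges G. edge_weight W x e)
        \<partial>(\<Pi>\<^sub>M v\<in>verts G. I01))"
      using G(1) W Q(1) g g0 Q(2) by (rule hom_density_pullback)
    also have "\<dots> = L / F ^ (m + 1)"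
      unfolding L_def G(3)[symmetric] by (simp add: g_def prod_dividef mult.commute)
    finally have hG: "hom_density G ?W' = L / F ^ (m + 1)" .
    have "hom_density K2 ?W' =
        (\<integral>x. W (x 0) (x 1) * f (x 0) * f (x 1) / F\<^sup>2 \<partial>(\<Pi>\<^sub>M v\<in>{0, 1::nat}. I01))"
      by (rule trans[OF hom_density_pullback[OF simple_graph_K2 W Q(1) g g0 Q(2)]],
          assumption, intro Bochner_Integration.integral_cong)
        (auto simp: K2_def space_PiM PiE_iff g_def power2_eq_square edge_weight_doubleton graphonD(2)[OF W])
    also have "\<dots> = (\<integral>x. W (x 0) (x 1) * f (x 0) * f (x 1) \<partial>(\<Pi>\<^sub>M v\<in>{0, 1::nat}. I01)) / F\<^sup>2"
      by simp
    also have "(\<integral>x. W (x 0) (x 1) * f (x 0) * f (x 1) \<partial>(\<Pi>\<^sub>M v\<in>{0, 1::nat}. I01)) = D"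
      unfolding D_def
    proof (rule integral_PiM_pair)
      show "(\<lambda>(x, y). W x y * f x * f y) \<in> borel_measurable (I01 \<Otimes>\<^sub>M I01)"
        by (auto simp: split_beta' intro!: borel_measurable_times
            graphonD(1)[OF W, unfolded split_beta'])
      show "W x y * f x * f y \<in> {0..1}" if "x \<in> {0..1}" "y \<in> {0..1}" for x y
        using graphonD(3,4)[OF W that] f01 that by (auto intro!: mult_le_one)
    qed
    finally have hK: "hom_density K2 ?W' = D / F\<^sup>2" .
    have "hom_density K2 ?W' ^ m \<le> hom_density G ?W'"
      using G(2) W' by (simp add: sidorenko_def m_def)
    then have "(D / F\<^sup>2) ^ m * F ^ (m + 1) \<le> L"
      using F by (simp add: hG hK field_simps)
    moreover have "(D / F\<^sup>2) ^ m * F ^ (m + 1) = F * (D / F) ^ m"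
      using F by (simp add: power_divide power2_eq_square power_mult_distrib)
    moreover have "F * (real m * a ^ (m - 1) * (D / F) - (real m - 1) * a ^ m) \<le> F * (D / F) ^ m"
      using F D0 a by (intro mult_left_mono power_ge_tangent) auto
    ultimately show ?thesis
      using F by (simp add: algebra_simps)
  qed
  then show ?thesis
    by (simp add: D_def F_def L_def)
qed

subsection \<open>Homomorphism densities of apex graphs\<close>

lemma mult_unit: "a * b \<in> {0..1}" if "a \<in> {0..1}" "b \<in> {0..1}" for a b :: real
  using that by (auto intro: mult_le_one)

lemma prod_unit: "(\<And>i. i \<in> A \<Longrightarrow> f i \<in> {0..1}) \<Longrightarrow> prod f A \<in> {0..1}" for f :: "'a \<Rightarrow> real"
  by (auto intro: prod_nonneg prod_le_1)

lemma graphon_unit: "graphon W \<Longrightarrow> x \<in> {0..1} \<Longrightarrow> y \<in> {0..1} \<Longrightarrow> W x y \<in> {0..1}"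
  by (simp add: graphon_def)

lemma space_PiM_I01D: "x \<in> space (\<Pi>\<^sub>M v\<in>V. I01) \<Longrightarrow> v \<in> V \<Longrightarrow> x v \<in> {0..1}"
  by (auto simp: space_PiM PiE_iff)

lemma (in prob_space) integral_unit_valued:
  fixes f :: "'a \<Rightarrow> real"
  assumes "\<And>x. x \<in> space M \<Longrightarrow> f x \<in> {0..1}"
  shows "integral\<^sup>L M f \<in> {0..1}"
\<comment> \<open>A non-integrable function has integral 0 by convention, which also lies in the
  unit interval.\<close>
proof (cases "integrable M f")
  case True
  with assms show ?thesis
    using integral_le_const[of f 1] by (auto intro!: Bochner_Integration.integral_nonneg)
qed (simp add: not_integrable_integral_eq)

lemma measurable_graphon:
  assumes "graphon W" "f \<in> M \<rightarrow>\<^sub>M I01" "g \<in> M \<rightarrow>\<^sub>M I01"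
  shows "(\<lambda>x. W (f x) (g x)) \<in> borel_measurable M"
proof -
  have "(\<lambda>x. case (f x, g x) of (a, b) \<Rightarrow> W a b) \<in> borel_measurable M"
    by (rule measurable_compose[OF _ graphonD(1)[OF assms(1)]]) (use assms in measurable)
  then show ?thesis by simp
qed

text \<open>Relabelling coordinates injectively preserves the uniform product measure. With
  \<open>r\<close> equal to \<open>Inl\<close> or \<open>Inr\<close> this strips the tags from the
  vertices of an apex graph.\<close>

lemma integral_PiM_reindex:
  fixes h :: "('a \<Rightarrow> real) \<Rightarrow> real"
  assumes "inj_on r V" and h: "h \<in> borel_measurable (\<Pi>\<^sub>M v\<in>V. I01)"
  shows "(\<integral>\<omega>. h (\<lambda>v\<in>V. \<omega> (r v)) \<partial>(\<Pi>\<^sub>M v\<in>r ` V. I01)) = (\<integral>x. h x \<partial>(\<Pi>\<^sub>M v\<in>V. I01))"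
proof -
  have "(\<Pi>\<^sub>M v\<in>V. I01) = distr (\<Pi>\<^sub>M v\<in>r ` V. I01) (\<Pi>\<^sub>M v\<in>V. I01) (\<lambda>\<omega>. \<lambda>v\<in>V. \<omega> (r v))"
    using distr_PiM_reindex[of "r ` V" "\<lambda>_. I01" r V] assms(1) I01.prob_space_axioms by simp
  then have "(\<integral>x. h x \<partial>(\<Pi>\<^sub>M v\<in>V. I01)) =
      (\<integral>x. h x \<partial>distr (\<Pi>\<^sub>M v\<in>r ` V. I01) (\<Pi>\<^sub>M v\<in>V. I01) (\<lambda>\<omega>. \<lambda>v\<in>V. \<omega> (r v)))"
    by simp
  also have "\<dots> = (\<integral>\<omega>. h (\<lambda>v\<in>V. \<omega> (r v)) \<partial>(\<Pi>\<^sub>M v\<in>r ` V. I01))"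
    by (rule integral_distr) (use h in \<open>auto intro!: measurable_restrict\<close>)
  finally show ?thesis by simp
qed

lemma apex_edges:
  fixes G :: "'a graph"
  shows "edges (apex k G) = (`) Inl ` edges G \<union> (\<lambda>(v, i). {Inl v, Inr i}) ` (verts G \<times> {..<k})"
    and "inj_on ((`) (Inl :: 'a \<Rightarrow> 'a + nat)) (edges G)"
    and "inj_on (\<lambda>(v, i). {Inl v, Inr i}) (verts G \<times> {..<k})"
    and "(`) Inl ` edges G \<inter> (\<lambda>(v, i). {Inl v, Inr i}) ` (verts G \<times> {..<k}) = {}"
proof -
  show "edges (apex k G) = (`) Inl ` edges G \<union> (\<lambda>(v, i). {Inl v, Inr i}) ` (verts G \<times> {..<k})"
    by (auto simp: apex_def)
  show "inj_on ((`) (Inl :: 'a \<Rightarrow> 'a + nat)) (edges G)"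
    by (rule inj_onI) (simp add: inj_image_eq_iff)
  show "inj_on (\<lambda>(v, i). {Inl v, Inr i}) (verts G \<times> {..<k})"
    by (auto simp: inj_on_def doubleton_eq_iff)
  have "Inr i \<notin> Inl ` A" for i A by auto
  then show "(`) Inl ` edges G \<inter> (\<lambda>(v, i). {Inl v, Inr i}) ` (verts G \<times> {..<k}) = {}"
    by auto
qed

lemma card_edges_apex:
  assumes "simple_graph G"
  shows "card (edges (apex k G)) = card (edges G) + card (verts G) * k"
  using apex_edges(2)[of G] apex_edges(3,4)[of G k] assms finite_edges[OF assms]
  by (simp add: apex_edges(1) card_Un_disjoint card_image card_cartesian_product simple_graph_def)

text \<open>The new vertices are pairwise non-adjacent, so each new edge has exactly one endpoint in
  \<open>G\<close>, and the weights of the new edges group into one factor per vertex of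
  \<open>G\<close>.\<close>

lemma prod_edge_weight_apex:
  assumes G: "simple_graph G" and W: "graphon W"
    and \<omega>: "\<omega> \<in> space (\<Pi>\<^sub>M v\<in>verts (apex k G). I01)"
  shows "(\<Prod>e\<in>edges (apex k G). edge_weight W \<omega> e) =
    (\<Prod>e\<in>edges G. edge_weight W (\<lambda>v\<in>verts G. \<omega> (Inl v)) e) *
    (\<Prod>v\<in>verts G. \<Prod>i<k. W (\<omega> (Inl v)) (\<omega> (Inr i)))"
proof -
  have range: "\<omega> (Inl v) \<in> {0..1}" "\<omega> (Inr i) \<in> {0..1}" if "v \<in> verts G" "i < k" for v i
    using \<omega> that by (auto simp: space_PiM PiE_iff apex_def)
  have rangeV: "\<omega> (Inl v) \<in> {0..1}" if "v \<in> verts G" for v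
    using \<omega> that by (auto simp: space_PiM PiE_iff apex_def)
  have "(\<Prod>e\<in>edges (apex k G). edge_weight W \<omega> e) =
      (\<Prod>e\<in>edges G. edge_weight W \<omega> (Inl ` e)) *
      (\<Prod>(v, i)\<in>verts G \<times> {..<k}. edge_weight W \<omega> {Inl v, Inr i})"
    using apex_edges(2)[of G] apex_edges(3,4)[of G k] G finite_edges[OF G]
    by (simp add: apex_edges(1) prod.union_disjoint prod.reindex simple_graph_def split_beta')
  moreover have "(\<Prod>e\<in>edges G. edge_weight W \<omega> (Inl ` e)) =
      (\<Prod>e\<in>edges G. edge_weight W (\<lambda>v\<in>verts G. \<omega> (Inl v)) e)"
  proof (intro prod.cong refl)
    fix e assume e: "e \<in> edges G"
    obtain u v where uv: "e = {u, v}" "u \<in> verts G" "v \<in> verts G"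
      using edge_weight_edge[OF G e] by metis
    show "edge_weight W \<omega> (Inl ` e) = edge_weight W (\<lambda>v\<in>verts G. \<omega> (Inl v)) e"
      using uv graphonD(2)[OF W rangeV[OF uv(2)] rangeV[OF uv(3)]]
      by (simp add: edge_weight_doubleton)
  qed
  moreover have "(\<Prod>(v, i)\<in>verts G \<times> {..<k}. edge_weight W \<omega> {Inl v, Inr i}) =
      (\<Prod>v\<in>verts G. \<Prod>i<k. W (\<omega> (Inl v)) (\<omega> (Inr i)))"
    unfolding prod.cartesian_product
    by (intro prod.cong refl) (use range in \<open>auto intro!: edge_weight_doubleton graphonD(2)[OF W]\<close>)
  ultimately show ?thesis by simp
qed

text \<open>Fubini, with the apex vertices outermost: for fixed \<open>y\<close> the inner integral
  is a density of \<open>G\<close> with vertex weights, as in \<open>sidorenko_weighted\<close>. The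
  second claim is needed to integrate bounds over \<open>y\<close>.\<close>

lemma hom_density_apex:
  assumes G: "simple_graph G" and W: "graphon W"
  shows "hom_density (apex k G) W =
    (\<integral>y. \<integral>x. (\<Prod>e\<in>edges G. edge_weight W x e) * (\<Prod>v\<in>verts G. \<Prod>i<k. W (x v) (y i))
      \<partial>(\<Pi>\<^sub>M v\<in>verts G. I01) \<partial>(\<Pi>\<^sub>M i\<in>{..<k}. I01))"
    and "(\<lambda>y. \<integral>x. (\<Prod>e\<in>edges G. edge_weight W x e) * (\<Prod>v\<in>verts G. \<Prod>i<k. W (x v) (y i))
      \<partial>(\<Pi>\<^sub>M v\<in>verts G. I01)) \<in> borel_measurable (\<Pi>\<^sub>M i\<in>{..<k}. I01)"
proof -
  let ?V = "verts G" and ?K = "{..<k}"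
  let ?PV = "\<Pi>\<^sub>M v\<in>?V. I01" and ?PK = "\<Pi>\<^sub>M i\<in>?K. I01"
  let ?LV = "Inl ` ?V :: ('a + nat) set" and ?RK = "Inr ` ?K :: ('a + nat) set"
  define P where "P y x = (\<Prod>e\<in>edges G. edge_weight W x e) * (\<Prod>v\<in>?V. \<Prod>i<k. W (x v) (y i))" for y x
  note [measurable (raw)] = measurable_graphon[OF W] and [measurable] = measurable_edge_weight[OF G _ W]
  interpret PV: prob_space ?PV
    by (intro prob_space_PiM I01.prob_space_axioms)
  interpret A: prob_space "\<Pi>\<^sub>M v\<in>verts (apex k G). I01"
    by (intro prob_space_PiM I01.prob_space_axioms)
  have P[measurable]: "(\<lambda>(y, x). P y x) \<in> borel_measurable (?PK \<Otimes>\<^sub>M ?PV)"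
    unfolding P_def by measurable
  have inner[measurable]: "(\<lambda>y. \<integral>x. P y x \<partial>?PV) \<in> borel_measurable ?PK"
    by measurable
  then show "(\<lambda>y. \<integral>x. (\<Prod>e\<in>edges G. edge_weight W x e) * (\<Prod>v\<in>verts G. \<Prod>i<k. W (x v) (y i))
      \<partial>(\<Pi>\<^sub>M v\<in>verts G. I01)) \<in> borel_measurable (\<Pi>\<^sub>M i\<in>{..<k}. I01)"
    by (simp add: P_def)
  \<comment> \<open>The \<open>Inr\<close> part comes first because the first set of the union gives
    the outer integral.\<close>
  have V: "verts (apex k G) = ?RK \<union> ?LV" and fin: "finite ?RK" "finite ?LV" and disj: "?RK \<inter> ?LV = {}"
    using G by (auto simp: apex_def simple_graph_def)
  define \<Phi> where "\<Phi> \<omega> = (\<Prod>e\<in>edges (apex k G). edge_weight W \<omega> e)" for \<omega>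
  have "integrable (\<Pi>\<^sub>M v\<in>verts (apex k G). I01) \<Phi>"
    unfolding \<Phi>_def
    by (rule A.integrable_unit_valued)
      (auto intro!: borel_measurable_prod measurable_edge_weight prod_nonneg prod_le_1
        simp: simple_graph_apex[OF G] W dest: edge_weight_range[OF simple_graph_apex[OF G] _ W])
  then have "hom_density (apex k G) W =
      (\<integral>y'. \<integral>x'. \<Phi> (merge ?RK ?LV (y', x')) \<partial>(\<Pi>\<^sub>M v\<in>?LV. I01) \<partial>(\<Pi>\<^sub>M v\<in>?RK. I01))"
    unfolding hom_density_def V \<Phi>_def[symmetric]
    by (intro I01_prod.product_integral_fold disj fin)
  also have "\<dots> = (\<integral>y'. \<integral>x'. P (\<lambda>i\<in>?K. y' (Inr i)) (\<lambda>v\<in>?V. x' (Inl v))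
      \<partial>(\<Pi>\<^sub>M v\<in>?LV. I01) \<partial>(\<Pi>\<^sub>M v\<in>?RK. I01))"
  proof (intro Bochner_Integration.integral_cong refl)
    fix y' x' assume "y' \<in> space (\<Pi>\<^sub>M v\<in>?RK. I01)" "x' \<in> space (\<Pi>\<^sub>M v\<in>?LV. I01)"
    then have "merge ?RK ?LV (y', x') \<in> space (\<Pi>\<^sub>M v\<in>verts (apex k G). I01)"
      unfolding V by (auto simp: space_PiM PiE_iff merge_def extensional_def)
    moreover have "Inl v \<notin> ?RK" "Inr i \<notin> ?LV" for v i
      by auto
    ultimately show "\<Phi> (merge ?RK ?LV (y', x')) = P (\<lambda>i\<in>?K. y' (Inr i)) (\<lambda>v\<in>?V. x' (Inl v))"
      unfolding \<Phi>_def P_def by (auto simp: prod_edge_weight_apex[OF G W] merge_def cong: restrict_cong)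
  qed
  also have "\<dots> = (\<integral>y'. \<integral>x. P (\<lambda>i\<in>?K. y' (Inr i)) x \<partial>?PV \<partial>(\<Pi>\<^sub>M v\<in>?RK. I01))"
  proof (intro Bochner_Integration.integral_cong refl integral_PiM_reindex)
    fix y' assume "y' \<in> space (\<Pi>\<^sub>M v\<in>?RK. I01)"
    then have "(\<lambda>i\<in>?K. y' (Inr i)) \<in> space ?PK"
      by (auto simp: space_PiM PiE_iff)
    from measurable_Pair2[OF P this]
    show "P (\<lambda>i\<in>?K. y' (Inr i)) \<in> borel_measurable ?PV" by simp
  qed auto
  also have "\<dots> = (\<integral>y. \<integral>x. P y x \<partial>?PV \<partial>?PK)"
    by (rule integral_PiM_reindex) (auto simp: inner)
  finally show "hom_density (apex k G) W =
    (\<integral>y. \<integral>x. (\<Prod>e\<in>edges G. edge_weight W x e) * (\<Prod>v\<in>verts G. \<Prod>i<k. W (x v) (y i))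
      \<partial>(\<Pi>\<^sub>M v\<in>verts G. I01) \<partial>(\<Pi>\<^sub>M i\<in>{..<k}. I01))"
    by (simp add: P_def)
qed

section \<open>Star and book densities through degrees and codegrees\<close>

definition deg :: "(real \<Rightarrow> real \<Rightarrow> real) \<Rightarrow> real \<Rightarrow> real" where
  "deg W s = (\<integral>u. W s u \<partial>I01)"

definition codeg :: "(real \<Rightarrow> real \<Rightarrow> real) \<Rightarrow> real \<Rightarrow> real \<Rightarrow> real" where
  "codeg W s t = (\<integral>u. W s u * W t u \<partial>I01)"

text \<open>For a fixed centre \<open>s\<close> the \<open>k\<close> leaves are independent, so
  their integral factors. Both sides are the density of the star with \<open>k\<close>
  leaves.\<close>

lemma integral_star_weights:
  assumes W: "graphon W"
  shows "(\<integral>y. \<integral>s. (\<Prod>i<k. W s (y i)) \<partial>I01 \<partial>(\<Pi>\<^sub>M i\<in>{..<k}. I01)) =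
    (\<integral>s. deg W s ^ k \<partial>I01)"
proof -
  let ?PK = "\<Pi>\<^sub>M i\<in>{..<k}. I01"
  note [measurable (raw)] = measurable_graphon[OF W]
  interpret PK: prob_space ?PK
    by (intro prob_space_PiM I01.prob_space_axioms)
  interpret PI: pair_prob_space ?PK I01 ..
  have "integrable (?PK \<Otimes>\<^sub>M I01) (\<lambda>(y, s). \<Prod>i<k. W s (y i))"
  proof (rule PI.integrable_unit_valued)
    show "(case z of (y, s) \<Rightarrow> \<Prod>i<k. W s (y i)) \<in> {0..1}" if "z \<in> space (?PK \<Otimes>\<^sub>M I01)" for z
      using that by (cases z, simp only: prod.case space_pair_measure mem_Times_iff fst_conv snd_conv space_I01)
        (intro prod_unit graphon_unit[OF W], auto dest: space_PiM_I01D)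
  qed measurable
  then have "(\<integral>y. \<integral>s. (\<Prod>i<k. W s (y i)) \<partial>I01 \<partial>?PK) = (\<integral>s. \<integral>y. (\<Prod>i<k. W s (y i)) \<partial>?PK \<partial>I01)"
    by (rule PI.Fubini_integral[symmetric])
  also have "\<dots> = (\<integral>s. deg W s ^ k \<partial>I01)"
  proof (intro Bochner_Integration.integral_cong refl)
    fix s assume s: "s \<in> space I01"
    then have "integrable I01 (W s)"
      using graphonD(3,4)[OF W] by (intro I01.integrable_unit_valued) auto
    then show "(\<integral>y. (\<Prod>i<k. W s (y i)) \<partial>?PK) = deg W s ^ k"
      by (subst I01_prod.product_integral_prod) (auto simp: deg_def)
  qed
  finally show ?thesis .
qed

text \<open>Both sides are the density of the \<open>k\<close>-apex of an edge, that is, of a book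
  of \<open>k\<close> triangles on a common spine. Two uses of Fubini move the integral over
  \<open>y\<close> innermost; for a fixed spine \<open>s\<close>, \<open>t\<close> it factors into
  \<open>k\<close> codegrees.\<close>

lemma integral_book_weights:
  assumes W: "graphon W"
  shows "(\<integral>y. \<integral>s. \<integral>t. W s t * (\<Prod>i<k. W s (y i)) * (\<Prod>i<k. W t (y i)) \<partial>I01 \<partial>I01 \<partial>(\<Pi>\<^sub>M i\<in>{..<k}. I01)) =
    (\<integral>s. \<integral>t. W s t * codeg W s t ^ k \<partial>I01 \<partial>I01)"
proof -
  let ?PK = "\<Pi>\<^sub>M i\<in>{..<k}. I01"
  let ?h = "\<lambda>y s t. W s t * (\<Prod>i<k. W s (y i)) * (\<Prod>i<k. W t (y i))"
  note [measurable (raw)] = measurable_graphon[OF W]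
  interpret PK: prob_space ?PK
    by (intro prob_space_PiM I01.prob_space_axioms)
  interpret PI: pair_prob_space ?PK I01 ..
  have range: "?h y s t \<in> {0..1}" if "y \<in> space ?PK" "s \<in> {0..1}" "t \<in> {0..1}" for y s t
    using that by (intro mult_unit prod_unit graphon_unit[OF W] space_PiM_I01D[of y "{..<k}"]) simp_all
  have "integrable (?PK \<Otimes>\<^sub>M I01) (\<lambda>(y, s). \<integral>t. ?h y s t \<partial>I01)"
  proof (rule PI.integrable_unit_valued)
    show "(case z of (y, s) \<Rightarrow> \<integral>t. ?h y s t \<partial>I01) \<in> {0..1}" if "z \<in> space (?PK \<Otimes>\<^sub>M I01)" for z
      using that by (cases z, simp only: prod.case space_pair_measure mem_Times_iff fst_conv snd_conv space_I01)
        (intro I01.integral_unit_valued range, simp_all)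
  qed measurable
  then have "(\<integral>y. \<integral>s. \<integral>t. ?h y s t \<partial>I01 \<partial>I01 \<partial>?PK) = (\<integral>s. \<integral>y. \<integral>t. ?h y s t \<partial>I01 \<partial>?PK \<partial>I01)"
    by (rule PI.Fubini_integral[symmetric])
  also have "\<dots> = (\<integral>s. \<integral>t. \<integral>y. ?h y s t \<partial>?PK \<partial>I01 \<partial>I01)"
  proof (intro Bochner_Integration.integral_cong refl)
    fix s assume s[measurable]: "s \<in> space I01"
    have "integrable (?PK \<Otimes>\<^sub>M I01) (\<lambda>(y, t). ?h y s t)"
    proof (rule PI.integrable_unit_valued)
      show "(case z of (y, t) \<Rightarrow> ?h y s t) \<in> {0..1}" if "z \<in> space (?PK \<Otimes>\<^sub>M I01)" for z
        using that s by (cases z, simp only: prod.case space_pair_measure mem_Times_iff fst_conv snd_conv space_I01)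
          (intro range, simp_all)
    qed measurable
    then show "(\<integral>y. \<integral>t. ?h y s t \<partial>I01 \<partial>?PK) = (\<integral>t. \<integral>y. ?h y s t \<partial>?PK \<partial>I01)"
      by (rule PI.Fubini_integral[symmetric])
  qed
  also have "\<dots> = (\<integral>s. \<integral>t. W s t * codeg W s t ^ k \<partial>I01 \<partial>I01)"
  proof (intro Bochner_Integration.integral_cong refl)
    fix s t assume st[measurable]: "s \<in> space I01" "t \<in> space I01"
    then have "integrable I01 (\<lambda>u. W s u * W t u)"
      using graphonD(3,4)[OF W] by (intro I01.integrable_unit_valued) (auto intro: mult_le_one)
    then have "(\<integral>y. (\<Prod>i<k. W s (y i) * W t (y i)) \<partial>?PK) = codeg W s t ^ k"
      by (subst I01_prod.product_integral_prod) (auto simp: codeg_def)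
    then show "(\<integral>y. ?h y s t \<partial>?PK) = W s t * codeg W s t ^ k"
      by (simp add: prod.distrib mult.assoc)
  qed
  finally show ?thesis .
qed

text \<open>\<open>sidorenko_weighted\<close> is applied for each fixed \<open>y\<close> to the
  weight \<open>\<Prod>i<k. W s (y i)\<close> and then integrated over \<open>y\<close>. Its bound
  is linear and \<open>a\<close> does not depend on \<open>y\<close>, so only the averages of the
  two integrals appear, which are a book and a star density.\<close>

lemma hom_density_apex_ge:
  fixes G :: "'a graph"
  defines "m \<equiv> card (edges G)"
  assumes G: "simple_graph G" "sidorenko G" "card (verts G) = m + 1"
    and W: "graphon W" and a: "0 \<le> a"
  shows "real m * a ^ (m - 1) * (\<integral>s. \<integral>t. W s t * codeg W s t ^ k \<partial>I01 \<partial>I01) -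
      (real m - 1) * a ^ m * (\<integral>s. deg W s ^ k \<partial>I01) \<le> hom_density (apex k G) W"
proof -
  let ?PK = "\<Pi>\<^sub>M i\<in>{..<k}. I01" and ?PV = "\<Pi>\<^sub>M v\<in>verts G. I01"
  let ?D = "\<lambda>y. \<integral>s. \<integral>t. W s t * (\<Prod>i<k. W s (y i)) * (\<Prod>i<k. W t (y i)) \<partial>I01 \<partial>I01"
  let ?F = "\<lambda>y. \<integral>s. (\<Prod>i<k. W s (y i)) \<partial>I01"
  let ?L = "\<lambda>y. \<integral>x. (\<Prod>e\<in>edges G. edge_weight W x e) * (\<Prod>v\<in>verts G. \<Prod>i<k. W (x v) (y i)) \<partial>?PV"
  note [measurable (raw)] = measurable_graphon[OF W]
  interpret PK: prob_space ?PK
    by (intro prob_space_PiM I01.prob_space_axioms)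
  interpret PV: prob_space ?PV
    by (intro prob_space_PiM I01.prob_space_axioms)
  have f01: "(\<Prod>i<k. W s (y i)) \<in> {0..1}" if "y \<in> space ?PK" "s \<in> {0..1}" for y s
    using that by (intro prod_unit graphon_unit[OF W] space_PiM_I01D[of y "{..<k}"]) simp_all
  have D01: "?D y \<in> {0..1}" if "y \<in> space ?PK" for y
    by (intro I01.integral_unit_valued mult_unit graphon_unit[OF W] f01[OF that]) simp_all
  have iD: "integrable ?PK ?D"
    by (rule PK.integrable_unit_valued[OF _ D01]) measurable
  have iF: "integrable ?PK ?F"
    by (rule PK.integrable_unit_valued[OF _ I01.integral_unit_valued]) (measurable, use f01 in auto)
  have L01: "?L y \<in> {0..1}" if y: "y \<in> space ?PK" for y
  proof (rule PV.integral_unit_valued)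
    fix x assume x: "x \<in> space ?PV"
    then show "(\<Prod>e\<in>edges G. edge_weight W x e) * (\<Prod>v\<in>verts G. \<Prod>i<k. W (x v) (y i)) \<in> {0..1}"
      by (intro mult_unit prod_unit[of "edges G"] prod_unit[of "verts G"] edge_weight_range[OF G(1) _ W]
          f01[OF y] space_PiM_I01D[of x])
  qed
  have iL: "integrable ?PK ?L"
    by (rule PK.integrable_unit_valued[OF hom_density_apex(2)[OF G(1) W] L01])
  have "(\<integral>y. real m * a ^ (m - 1) * ?D y - (real m - 1) * a ^ m * ?F y \<partial>?PK) \<le> (\<integral>y. ?L y \<partial>?PK)"
  proof (rule integral_mono[OF _ iL])
    show "integrable ?PK (\<lambda>y. real m * a ^ (m - 1) * ?D y - (real m - 1) * a ^ m * ?F y)"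
      using iD iF by (intro Bochner_Integration.integrable_diff integrable_mult_right)
    fix y assume y: "y \<in> space ?PK"
    then have [measurable]: "(\<lambda>s. \<Prod>i<k. W s (y i)) \<in> borel_measurable I01"
      by (intro borel_measurable_prod measurable_graphon[OF W]) (auto simp: space_PiM PiE_iff)
    show "real m * a ^ (m - 1) * ?D y - (real m - 1) * a ^ m * ?F y \<le> ?L y"
      using G W a f01[OF y] unfolding m_def by (intro sidorenko_weighted) auto
  qed
  then show ?thesis
    using iD iF
    by (simp add: hom_density_apex(1)[OF G(1) W] integral_star_weights[OF W] integral_book_weights[OF W])
qed

subsection \<open>Monochromatic books and stars\<close>

lemma prob_I01: "measure I01 {0..1} = 1"
  using I01.prob_space by simp

text \<open>With \<open>u = 2 * d - 1\<close> only even powers of \<open>u\<close> survive, and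
  \<open>u^4\<close> \<le> \<open>u^2\<close> bounds the scaled sum by
  \<open>2 + (2^k - 2) * u^2\<close>. The slope \<open>6 * k\<close> is what
  \<open>book_star_inequality\<close> can afford; it suffices up to \<open>k = 5\<close>, where
  \<open>2^k - 2 = 30 = 6 * k\<close>.\<close>

lemma power_sum_le:
  fixes d :: real
  assumes "k \<in> {1, 2, 3, 4, 5::nat}" "0 \<le> d" "d \<le> 1"
  shows "d ^ k + (1 - d) ^ k \<le> (1/2) ^ k * (2 + 6 * real k * (2 * d - 1)\<^sup>2)"
proof -
  define u where "u = 2 * d - 1"
  have d: "d = (1 + u) / 2" by (simp add: u_def)
  have "u\<^sup>2 \<le> 1"
    using assms by (simp add: u_def abs_le_square_iff[symmetric, of _ 1, simplified])
  then have 4: "u ^ 4 \<le> u\<^sup>2"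
    using mult_left_mono[of "u\<^sup>2" 1 "u\<^sup>2"] by (simp add: power4_eq_xxxx power2_eq_square mult.assoc)
  \<comment> \<open>The case \<open>k = 4\<close> reduces to this, the case \<open>k = 5\<close> to
    the fact \<open>4\<close>.\<close>
  then have "u ^ 4 \<le> 6 * u\<^sup>2"
    using zero_le_power2[of u] by linarith
  with 4 have "(1 + u) ^ k + (1 - u) ^ k \<le> 2 + 6 * real k * u\<^sup>2"
    using assms(1)
    by (auto simp: eval_nat_numeral algebra_simps)
  moreover have "d ^ k + (1 - d) ^ k = (1/2) ^ k * ((1 + u) ^ k + (1 - u) ^ k)"
  proof -
    have "1 - d = (1/2) * (1 - u)" "d = (1/2) * (1 + u)"
      by (simp_all add: d field_simps)
    then show ?thesis
      by (metis power_mult_distrib distrib_left)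
  qed
  ultimately show ?thesis
    by (simp add: u_def[symmetric])
qed

text \<open>Both powers are bounded by tangents at 1/2; as the two bases add up to 1, the sum of the
  tangents is constant.\<close>

lemma power_sum_ge:
  fixes d :: real
  assumes "0 \<le> d" "d \<le> 1"
  shows "2 * (1/2) ^ k \<le> d ^ k + (1 - d) ^ k"
  using power_ge_tangent[of d "1/2" k] power_ge_tangent[of "1 - d" "1/2" k] assms
  by (cases k) (auto simp: algebra_simps)

lemma power_unit: "a ^ k \<in> {0..1}" if "a \<in> {0..1}" for a :: real
  using that by (auto intro: power_le_one)

section \<open>Degree and codegree moments of a graphon and its complement\<close>

context
  fixes W
  assumes W: "graphon W"
begin

lemma measurable_deg: "deg W \<in> borel_measurable I01"
proof -
  note [measurable (raw)] = measurable_graphon[OF W]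
  show ?thesis
    unfolding deg_def[abs_def] by measurable
qed

lemma measurable_codeg: "(\<lambda>(s, t). codeg W s t) \<in> borel_measurable (I01 \<Otimes>\<^sub>M I01)"
proof -
  note [measurable (raw)] = measurable_graphon[OF W]
  show ?thesis
    unfolding codeg_def by measurable
qed

lemma integrable_row: "s \<in> {0..1} \<Longrightarrow> integrable I01 (W s)"
  using graphon_unit[OF W] by (intro I01.integrable_unit_valued measurable_graphon[OF W]) auto

lemma deg_unit: "s \<in> {0..1} \<Longrightarrow> deg W s \<in> {0..1}"
  unfolding deg_def by (intro I01.integral_unit_valued graphon_unit[OF W]) simp_all

lemma codeg_unit: "s \<in> {0..1} \<Longrightarrow> t \<in> {0..1} \<Longrightarrow> codeg W s t \<in> {0..1}"
  unfolding codeg_def by (intro I01.integral_unit_valued mult_unit graphon_unit[OF W]) simp_all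

lemma deg_complement: "s \<in> {0..1} \<Longrightarrow> deg (\<lambda>x y. 1 - W x y) s = 1 - deg W s"
  using integrable_row[of s] by (simp add: deg_def prob_I01)

lemma codeg_complement:
  assumes "s \<in> {0..1}" "t \<in> {0..1}"
  shows "codeg (\<lambda>x y. 1 - W x y) s t = 1 - deg W s - deg W t + codeg W s t"
proof -
  have "integrable I01 (\<lambda>u. W s u * W t u)"
    using assms graphon_unit[OF W]
    by (intro I01.integrable_unit_valued borel_measurable_times measurable_graphon[OF W] mult_unit) auto
  moreover have "codeg (\<lambda>x y. 1 - W x y) s t = (\<integral>u. 1 - W s u - W t u + W s u * W t u \<partial>I01)"
    unfolding codeg_def by (intro Bochner_Integration.integral_cong) (auto simp: algebra_simps)
  ultimately show ?thesis
    using assms integrable_row by (simp add: deg_def codeg_def prob_I01)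
qed

lemma deg_moment_complement:
  "(\<integral>s. deg (\<lambda>x y. 1 - W x y) s ^ k \<partial>I01) = (\<integral>s. (1 - deg W s) ^ k \<partial>I01)"
  by (intro Bochner_Integration.integral_cong) (simp_all add: deg_complement)

lemma integrable_deg_power:
  "integrable I01 (\<lambda>s. deg W s ^ k)" "integrable I01 (\<lambda>s. (1 - deg W s) ^ k)"
proof -
  note [measurable] = measurable_deg
  have "1 - deg W s \<in> {0..1}" if "s \<in> {0..1}" for s
    using deg_unit[OF that] by simp
  then show "integrable I01 (\<lambda>s. deg W s ^ k)" "integrable I01 (\<lambda>s. (1 - deg W s) ^ k)"
    using deg_unit by (auto intro!: I01.integrable_unit_valued power_unit simp del: atLeastAtMost_iff)
qed

text \<open>This is commonness of stars, by averaging \<open>power_sum_ge\<close> over the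
  centre.\<close>

lemma deg_moment_ge:
  "2 * (1/2) ^ k \<le> (\<integral>s. deg W s ^ k \<partial>I01) + (\<integral>s. deg (\<lambda>x y. 1 - W x y) s ^ k \<partial>I01)"
proof -
  have "(\<integral>s. 2 * (1/2) ^ k \<partial>I01) \<le> (\<integral>s. deg W s ^ k + (1 - deg W s) ^ k \<partial>I01)"
    using deg_unit
    by (intro integral_mono power_sum_ge Bochner_Integration.integrable_add integrable_deg_power) auto
  then show ?thesis
    using integrable_deg_power[of k] by (simp add: deg_moment_complement prob_I01)
qed

text \<open>The last bracket is the mean of \<open>(2 * deg W s - 1)^2\<close>, expanded into the
  two degree moments that also occur in Goodman's identity.\<close>

lemma deg_moment_le:
  assumes "k \<in> {1, 2, 3, 4, 5}"
  shows "(\<integral>s. deg W s ^ k \<partial>I01) + (\<integral>s. deg (\<lambda>x y. 1 - W x y) s ^ k \<partial>I01) \<le>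
    (1/2) ^ k * (2 + 6 * real k * (1 - 4 * (\<integral>s. deg W s \<partial>I01) + 4 * (\<integral>s. (deg W s)\<^sup>2 \<partial>I01)))"
proof -
  have int: "integrable I01 (deg W)" "integrable I01 (\<lambda>s. (deg W s)\<^sup>2)"
    using integrable_deg_power(1)[of 1] integrable_deg_power(1)[of 2] by auto
  have eq: "(2 * d - 1)\<^sup>2 = 4 * d\<^sup>2 - 4 * d + 1" for d :: real
    by (simp add: power2_eq_square algebra_simps)
  have "(\<integral>s. deg W s ^ k + (1 - deg W s) ^ k \<partial>I01) \<le>
      (\<integral>s. (1/2) ^ k * (2 + 6 * real k * (4 * (deg W s)\<^sup>2 - 4 * deg W s + 1)) \<partial>I01)"
    using deg_unit int
    by (intro integral_mono power_sum_le[OF assms, unfolded eq] Bochner_Integration.integrable_add integrable_deg_power) auto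
  also have "\<dots> = (1/2) ^ k * (2 + 6 * real k * (1 - 4 * (\<integral>s. deg W s \<partial>I01) + 4 * (\<integral>s. (deg W s)\<^sup>2 \<partial>I01)))"
    using int by (simp add: prob_I01)
  finally show ?thesis
    using integrable_deg_power[of k] by (simp add: deg_moment_complement)
qed

lemma integrable_book:
  "integrable (I01 \<Otimes>\<^sub>M I01) (\<lambda>(s, t). W s t * codeg W s t ^ k)"
proof (rule I01_pair.integrable_unit_valued)
  note [measurable (raw)] = measurable_graphon[OF W]
  note [measurable] = measurable_codeg
  show "(\<lambda>(s, t). W s t * codeg W s t ^ k) \<in> borel_measurable (I01 \<Otimes>\<^sub>M I01)"
    by measurable
  show "(case z of (s, t) \<Rightarrow> W s t * codeg W s t ^ k) \<in> {0..1}" if "z \<in> space (I01 \<Otimes>\<^sub>M I01)" for z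
    using that by (cases z, simp only: prod.case space_pair_measure mem_Times_iff fst_conv snd_conv space_I01)
      (intro mult_unit power_unit graphon_unit[OF W] codeg_unit, simp_all)
qed

end

text \<open>Goodman's identity: the monochromatic triangle density is a function of the degrees.\<close>

lemma goodman:
  assumes W: "graphon W"
  defines "G \<equiv> \<lambda>(s, t). W s t * codeg W s t + (1 - W s t) * codeg (\<lambda>x y. 1 - W x y) s t"
  shows "integrable (I01 \<Otimes>\<^sub>M I01) G"
    and "integral\<^sup>L (I01 \<Otimes>\<^sub>M I01) G = 1 - 3 * (\<integral>s. deg W s \<partial>I01) + 3 * (\<integral>s. (deg W s)\<^sup>2 \<partial>I01)"
proof -
  note [measurable (raw)] = measurable_graphon[OF W]
  note [measurable] = measurable_deg[OF W]
  let ?P = "I01 \<Otimes>\<^sub>M I01"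
  \<comment> \<open>The density of two-edge paths starting at \<open>s\<close>. Counting them from
    the middle vertex instead gives the second degree moment.\<close>
  let ?e = "\<lambda>s. \<integral>u. W s u * deg W u \<partial>I01"
  have row: "integrable I01 (\<lambda>u. W s u * deg W u)" if [measurable]: "s \<in> space I01" for s
    using that by (intro I01.integrable_unit_valued mult_unit graphon_unit[OF W] deg_unit[OF W]) simp_all
  have col: "(\<integral>s. W s u \<partial>I01) = deg W u" if "u \<in> {0..1}" for u
    unfolding deg_def using that graphonD(2)[OF W] by (intro Bochner_Integration.integral_cong) auto
  have "integrable ?P (\<lambda>(s, u). W s u * deg W u)"
    by (rule I01_pair.integrable_unit_valued)
      (measurable, auto simp: space_pair_measure simp del: atLeastAtMost_iff
        intro!: mult_unit graphon_unit[OF W] deg_unit[OF W])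
  from I01_pair.Fubini_integral[OF this]
  have "(\<integral>s. ?e s \<partial>I01) = (\<integral>u. (\<integral>s. W s u * deg W u \<partial>I01) \<partial>I01)" by simp
  also have "\<dots> = (\<integral>u. (deg W u)\<^sup>2 \<partial>I01)"
    by (intro Bochner_Integration.integral_cong) (simp_all add: col power2_eq_square)
  finally have e: "(\<integral>s. ?e s \<partial>I01) = (\<integral>u. (deg W u)\<^sup>2 \<partial>I01)" .
  have codeg_row: "(\<integral>t. codeg W s t \<partial>I01) = ?e s" if s[measurable]: "s \<in> space I01" for s
  proof -
    have "integrable ?P (\<lambda>(t, u). W s u * W t u)"
      by (rule I01_pair.integrable_unit_valued)
        (measurable, use s in \<open>auto simp: space_pair_measure simp del: atLeastAtMost_iff
          intro!: mult_unit graphon_unit[OF W]\<close>)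
    from I01_pair.Fubini_integral[OF this]
    have "(\<integral>t. codeg W s t \<partial>I01) = (\<integral>u. (\<integral>t. W s u * W t u \<partial>I01) \<partial>I01)"
      by (simp add: codeg_def)
    also have "\<dots> = ?e s"
      by (intro Bochner_Integration.integral_cong) (simp_all add: col)
    finally show ?thesis .
  qed
  have icodeg: "integrable I01 (codeg W s)" if [measurable]: "s \<in> space I01" for s
    using that measurable_Pair2[OF measurable_codeg[OF W] that]
    by (intro I01.integrable_unit_valued codeg_unit[OF W]) simp_all
  show int: "integrable ?P G"
    using Bochner_Integration.integrable_add[OF integrable_book[OF W, of 1] integrable_book[OF graphon_complement[OF W], of 1]]
    by (simp add: G_def split_beta')
  have "integral\<^sup>L ?P G = (\<integral>s. \<integral>t. G (s, t) \<partial>I01 \<partial>I01)"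
    by (rule I01_pair.integral_fst'[OF int, symmetric])
  also have "\<dots> = (\<integral>s. 1 - 2 * deg W s - (\<integral>t. deg W t \<partial>I01) + (deg W s)\<^sup>2 + 2 * ?e s \<partial>I01)"
  proof (intro Bochner_Integration.integral_cong refl)
    fix s assume s: "s \<in> space I01"
    \<comment> \<open>Inclusion-exclusion for the complement produces
      \<open>- W s t * codeg W s t\<close>, which cancels the triangle term; only edges and two-edge
      paths remain.\<close>
    have "(\<integral>t. G (s, t) \<partial>I01) =
        (\<integral>t. 1 - deg W s - deg W t - W s t + codeg W s t + W s t * deg W s + W s t * deg W t \<partial>I01)"
      using s by (intro Bochner_Integration.integral_cong) (auto simp: G_def codeg_complement[OF W] algebra_simps)
    also have "\<dots> = 1 - deg W s - (\<integral>t. deg W t \<partial>I01) - deg W s + ?e s + deg W s * deg W s + ?e s"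
      using s row[OF s] icodeg[OF s] integrable_row[OF W, of s] integrable_deg_power(1)[OF W, of 1] codeg_row[OF s]
      by (simp add: prob_I01 flip: deg_def)
    finally show "(\<integral>t. G (s, t) \<partial>I01) =
        1 - 2 * deg W s - (\<integral>t. deg W t \<partial>I01) + (deg W s)\<^sup>2 + 2 * ?e s"
      by (simp add: power2_eq_square)
  qed
  also have "\<dots> = 1 - 3 * (\<integral>s. deg W s \<partial>I01) + 3 * (\<integral>s. (deg W s)\<^sup>2 \<partial>I01)"
  proof -
    have "integrable I01 ?e"
      by (rule I01.integrable_unit_valued[OF _ I01.integral_unit_valued[OF mult_unit]])
        (measurable, simp_all del: atLeastAtMost_iff add: graphon_unit[OF W] deg_unit[OF W])
    then show ?thesis
      using integrable_deg_power(1)[OF W, of 1] integrable_deg_power(1)[OF W, of 2]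
      by (simp add: prob_I01 e)
  qed
  finally show "integral\<^sup>L ?P G = 1 - 3 * (\<integral>s. deg W s \<partial>I01) + 3 * (\<integral>s. (deg W s)\<^sup>2 \<partial>I01)" .
qed

text \<open>Bounding the powers of the codegrees by tangents at 1/4, the codegree in the constant
  graphon 1/2, leaves a linear function of the monochromatic triangle density. By Goodman's identity
  the latter is \<open>1/4 + 3/4 * q\<close>, with \<open>q\<close> the mean of
  \<open>(2 * deg W s - 1)^2\<close>. The resulting lower bound for books coincides with the scaled
  upper bound for stars from \<open>deg_moment_le\<close>.\<close>

lemma book_star_inequality:
  assumes W: "graphon W" and k: "k \<in> {1, 2, 3, 4, 5}"
  defines "W' \<equiv> \<lambda>x y. 1 - W x y"
  shows "(1/2) ^ (k + 1) * ((\<integral>s. deg W s ^ k \<partial>I01) + (\<integral>s. deg W' s ^ k \<partial>I01)) \<le>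
    (\<integral>s. \<integral>t. W s t * codeg W s t ^ k \<partial>I01 \<partial>I01) + (\<integral>s. \<integral>t. W' s t * codeg W' s t ^ k \<partial>I01 \<partial>I01)"
proof -
  have W': "graphon W'"
    unfolding W'_def using W by (rule graphon_complement)
  let ?P = "I01 \<Otimes>\<^sub>M I01"
  let ?G = "\<lambda>(s, t). W s t * codeg W s t + W' s t * codeg W' s t"
  let ?q = "1 - 4 * (\<integral>s. deg W s \<partial>I01) + 4 * (\<integral>s. (deg W s)\<^sup>2 \<partial>I01)"
  have k4: "(1/4::real) ^ (k - 1) = 4 * (1/4) ^ k"
    using k by (cases k) auto
  have int: "integrable ?P ?G" and val: "integral\<^sup>L ?P ?G =
      1 - 3 * (\<integral>s. deg W s \<partial>I01) + 3 * (\<integral>s. (deg W s)\<^sup>2 \<partial>I01)"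
    unfolding W'_def by (rule goodman[OF W])+
  have "(1/4) ^ k * (1 + 3 * real k * ?q) =
      real k * (1/4) ^ (k - 1) * integral\<^sup>L ?P ?G - (real k - 1) * (1/4) ^ k"
    unfolding val k4 by (simp add: algebra_simps)
  also have "\<dots> = (\<integral>z. real k * (1/4) ^ (k - 1) * ?G z - (real k - 1) * (1/4) ^ k \<partial>?P)"
    using int I01_pair.prob_space by simp
  also have "\<dots> \<le> (\<integral>z. (\<lambda>(s, t). W s t * codeg W s t ^ k) z + (\<lambda>(s, t). W' s t * codeg W' s t ^ k) z \<partial>?P)"
  proof (rule integral_mono)
    show "integrable ?P (\<lambda>z. real k * (1/4) ^ (k - 1) * ?G z - (real k - 1) * (1/4) ^ k)"
      using int by simp
    show "integrable ?P (\<lambda>z. (\<lambda>(s, t). W s t * codeg W s t ^ k) z + (\<lambda>(s, t). W' s t * codeg W' s t ^ k) z)"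
      by (intro Bochner_Integration.integrable_add integrable_book W W')
    fix z assume "z \<in> space ?P"
    then obtain s t where z: "z = (s, t)" and st: "s \<in> {0..1}" "t \<in> {0..1}"
      by (auto simp: space_pair_measure)
    let ?T = "\<lambda>r. real k * (1/4) ^ (k - 1) * r - (real k - 1) * (1/4) ^ k"
    \<comment> \<open>The weights \<open>W s t\<close> and \<open>W' s t\<close> add up to 1, so the
      constant term of the tangent comes out unweighted.\<close>
    have "W s t * ?T (codeg W s t) + W' s t * ?T (codeg W' s t) \<le>
        W s t * codeg W s t ^ k + W' s t * codeg W' s t ^ k"
      using codeg_unit[OF W st] codeg_unit[OF W' st] graphonD(3)[OF W st] graphonD(3)[OF W' st]
      by (intro add_mono mult_left_mono power_ge_tangent) auto
    then show "real k * (1/4) ^ (k - 1) * ?G z - (real k - 1) * (1/4) ^ k \<le>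
        (\<lambda>(s, t). W s t * codeg W s t ^ k) z + (\<lambda>(s, t). W' s t * codeg W' s t ^ k) z"
      by (simp add: z W'_def algebra_simps)
  qed
  also have "\<dots> = (\<integral>s. \<integral>t. W s t * codeg W s t ^ k \<partial>I01 \<partial>I01) + (\<integral>s. \<integral>t. W' s t * codeg W' s t ^ k \<partial>I01 \<partial>I01)"
    by (simp add: integrable_book W W' I01_pair.integral_fst[OF integrable_book[OF W]]
        I01_pair.integral_fst[OF integrable_book[OF W']])
  finally have book: "(1/4) ^ k * (1 + 3 * real k * ?q) \<le>
      (\<integral>s. \<integral>t. W s t * codeg W s t ^ k \<partial>I01 \<partial>I01) + (\<integral>s. \<integral>t. W' s t * codeg W' s t ^ k \<partial>I01 \<partial>I01)" .
  have "(1/2) ^ (k + 1) * ((\<integral>s. deg W s ^ k \<partial>I01) + (\<integral>s. deg W' s ^ k \<partial>I01)) \<le>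
      (1/2) ^ (k + 1) * ((1/2) ^ k * (2 + 6 * real k * ?q))"
    using deg_moment_le[OF W k] unfolding W'_def by (intro mult_left_mono) auto
  also have "\<dots> = ((1/2) ^ k * (1/2) ^ k) * (1 + 3 * real k * ?q)"
    by (simp add: algebra_simps)
  also have "(1/2) ^ k * (1/2) ^ k = (1/4::real) ^ k"
    by (simp flip: power_mult_distrib)
  finally show ?thesis
    using book by linarith
qed

section \<open>Combination of the bounds for a graphon and its complement\<close>

theorem theorem2:
  fixes G :: "'a graph" and n k :: nat
  assumes "simple_graph G"
    and "card (verts G) = n" and "n \<ge> 1"
    and "card (edges G) = n - 1"
    and "sidorenko G"
    and "k \<in> {1, 2, 3, 4, 5}"
  shows "common_graph (apex k G)"
  unfolding common_graph_def
proof (intro allI impI)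
  fix W assume W: "graphon W"
  define m where "m = n - 1"
  \<comment> \<open>This is the ratio of book to star density in the constant graphon 1/2, so the
    tangent bound is sharp there.\<close>
  define a :: real where "a = (1/2) ^ (k + 1)"
  have cV: "card (verts G) = card (edges G) + 1" and cE: "card (edges G) = m"
    using assms by (simp_all add: m_def)
  note bound = hom_density_apex_ge[OF assms(1,5) cV, of _ a k, unfolded cE]
  let ?W' = "\<lambda>x y. 1 - W x y"
  let ?B = "\<lambda>W. \<integral>s. \<integral>t. W s t * codeg W s t ^ k \<partial>I01 \<partial>I01"
  let ?S = "\<lambda>W. \<integral>s. deg W s ^ k \<partial>I01"
  have a0: "0 \<le> a" by (simp add: a_def)
  have "2 powr (1 - real N) = 2 * (1/2) ^ N" for N
    by (simp add: powr_diff powr_realpow power_one_over)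
  then have "2 powr (1 - real (card (edges (apex k G)))) = 2 * (1/2) ^ (m + (m + 1) * k)"
    using cV cE by (simp only: card_edges_apex[OF assms(1)])
  \<comment> \<open>The number of edges is regrouped as
    \<open>m + (m + 1) * k = m * (k + 1) + k\<close>.\<close>
  also have "\<dots> = a ^ m * (2 * (1/2) ^ k)"
    by (simp add: a_def flip: power_mult power_add power_Suc) (simp add: algebra_simps)
  also have "\<dots> \<le> a ^ m * (?S W + ?S ?W')"
    using deg_moment_ge[OF W] a0 by (intro mult_left_mono) auto
  \<comment> \<open>The books contribute at least \<open>m * a^m\<close> times the stars, and
    subtracting \<open>(m - 1) * a^m\<close> times the stars leaves exactly \<open>a^m\<close> times
    them.\<close>
  also have "\<dots> \<le> real m * a ^ (m - 1) * (?B W + ?B ?W') - (real m - 1) * a ^ m * (?S W + ?S ?W')"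
  proof -
    have "real m * a ^ (m - 1) * (a * (?S W + ?S ?W')) \<le> real m * a ^ (m - 1) * (?B W + ?B ?W')"
      using book_star_inequality[OF W assms(6)] a0 unfolding a_def by (intro mult_left_mono) auto
    moreover have "real m * a ^ (m - 1) * (a * (?S W + ?S ?W')) = real m * a ^ m * (?S W + ?S ?W')"
      by (cases m) auto
    ultimately show ?thesis
      by (simp add: algebra_simps)
  qed
  also have "\<dots> \<le> mono_density (apex k G) W"
    using bound[OF W a0] bound[OF graphon_complement[OF W] a0]
    unfolding mono_density_def by (simp add: algebra_simps)
  finally show "2 powr (1 - real (card (edges (apex k G)))) \<le> mono_density (apex k G) W" .
qed

end
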